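(* Let $X$ be a Banach space over $\mathbb K$, let $K$ be a compact subset of the unit sphere $S_X$, and let $f\in C(K,X)$. Then $f$ is $nr$-left symmetric if and only if there exists $k_0\in K$ such that the following conditions hold: (i) for every $k\in K$ with $k\neq k_0$ and every $x^*\in J(k)$, $x^*(f(k))=0$; (ii) $f(k_0)$ is left symmetric with respect to $v_{k_0}(\cdot)$.
   Context: $\mathbb K$ is the scalar field ($\mathbb R$ or $\mathbb C$), $S_X$ the unit sphere of $X$, $X^*$ the dual of $X$. $C(K,X)$ is the space of continuous functions $f:K\to X$ (for the norm topologies). For $u\in S_X$: $J(u)=\{x^*\in S_{X^*}:x^*(u)=1\}$ and $v_u(x)=\sup_{x^*\in J(u)}|x^*(x)|$ for $x\in X$ (a semi-norm on $X$). Write $x\perp_{v_u}y$ if $v_u(x+\lambda y)\ge v_u(x)$ for all $\lambda\in\mathbb K$. An element $x\in X$ is left symmetric with respect to $v_u(\cdot)$ if for every $y\in X$, $x\perp_{v_u}y$ implies $y\perp_{v_u}x$. $\Pi(K,X)=\{(k,x^* ):k\in K,\ x^*\in J(k)\}$ and, for $f\in C(K,X)$, $\|f\|_w=\sup\{|x^*(f(k))|:(k,x^* )\in\Pi(K,X)\}$ (a semi-norm on $C(K,X)$). Write $f\perp_w g$ if $\|f+\lambda g\|_w\ge\|f\|_w$ for all $\lambda\in\mathbb K$. A function $f\in C(K,X)$ is $nr$-left symmetric if for every $g\in C(K,X)$, $f\perp_w g$ implies $g\perp_w f$. *)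

theory Defs
  imports "HOL-Analysis.Analysis"
begin

text \<open>The scalar field, up to isometric isomorphism either the reals or the complex numbers.\<close>

class real_or_complex = real_normed_field +
  assumes ex_isometric_embedding:
    "\<exists>h :: 'a \<Rightarrow> complex.
       (\<forall>a b. h (a + b) = h a + h b) \<and> (\<forall>a b. h (a * b) = h a * h b) \<and>
       (\<forall>a. norm (h a) = norm a) \<and> (range h = \<real> \<or> range h = UNIV)"

instance real :: real_or_complex
  by standard (rule exI[of _ complex_of_real], auto simp: Reals_def)

instance complex :: real_or_complex
  by standard (rule exI[of _ "\<lambda>z. z"], auto)

text \<open>
  A Banach space over \<open>'k\<close>: the class \<open>banach\<close> supplies the norm, completeness and the
  underlying real vector space, and \<open>smul\<close> is the multiplication by scalars from \<open>'k\<close>.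
\<close>

locale banach_space_over = vector_space smul
  for smul :: "'k::real_or_complex \<Rightarrow> 'x::banach \<Rightarrow> 'x" +
  assumes smul_of_real: "smul (of_real r) x = r *\<^sub>R x"
    and norm_smul: "norm (smul a x) = norm a * norm x"

definition dual_space :: "('k::real_or_complex \<Rightarrow> 'x::banach \<Rightarrow> 'x) \<Rightarrow> ('x \<Rightarrow> 'k) set" where
  "dual_space smul = {\<phi>. bounded_linear \<phi> \<and> (\<forall>a x. \<phi> (smul a x) = a * \<phi> x)}"

definition J :: "('k::real_or_complex \<Rightarrow> 'x::banach \<Rightarrow> 'x) \<Rightarrow> 'x \<Rightarrow> ('x \<Rightarrow> 'k) set" where
  "J smul u = {\<phi> \<in> dual_space smul. onorm \<phi> = 1 \<and> \<phi> u = 1}"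

definition v_seminorm :: "('k::real_or_complex \<Rightarrow> 'x::banach \<Rightarrow> 'x) \<Rightarrow> 'x \<Rightarrow> 'x \<Rightarrow> real" where
  "v_seminorm smul u x = (SUP \<phi>\<in>J smul u. norm (\<phi> x))"

definition v_orthogonal :: "('k::real_or_complex \<Rightarrow> 'x::banach \<Rightarrow> 'x) \<Rightarrow> 'x \<Rightarrow> 'x \<Rightarrow> 'x \<Rightarrow> bool" where
  "v_orthogonal smul u x y \<longleftrightarrow>
     (\<forall>a. v_seminorm smul u (x + smul a y) \<ge> v_seminorm smul u x)"

definition v_left_symmetric :: "('k::real_or_complex \<Rightarrow> 'x::banach \<Rightarrow> 'x) \<Rightarrow> 'x \<Rightarrow> 'x \<Rightarrow> bool" where
  "v_left_symmetric smul u x \<longleftrightarrow>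
     (\<forall>y. v_orthogonal smul u x y \<longrightarrow> v_orthogonal smul u y x)"

text \<open>
  Elements of \<open>C(K,X)\<close> are represented by total functions that are continuous on \<open>K\<close>;
  the notions below depend only on their values on \<open>K\<close>.
\<close>

definition Pi_set :: "('k::real_or_complex \<Rightarrow> 'x::banach \<Rightarrow> 'x) \<Rightarrow> 'x set \<Rightarrow> ('x \<times> ('x \<Rightarrow> 'k)) set" where
  "Pi_set smul K = {(k, \<phi>). k \<in> K \<and> \<phi> \<in> J smul k}"

definition w_seminorm :: "('k::real_or_complex \<Rightarrow> 'x::banach \<Rightarrow> 'x) \<Rightarrow> 'x set \<Rightarrow> ('x \<Rightarrow> 'x) \<Rightarrow> real" where
  "w_seminorm smul K f = (SUP (k, \<phi>)\<in>Pi_set smul K. norm (\<phi> (f k)))"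

definition w_orthogonal ::
    "('k::real_or_complex \<Rightarrow> 'x::banach \<Rightarrow> 'x) \<Rightarrow> 'x set \<Rightarrow> ('x \<Rightarrow> 'x) \<Rightarrow> ('x \<Rightarrow> 'x) \<Rightarrow> bool" where
  "w_orthogonal smul K f g \<longleftrightarrow>
     (\<forall>a. w_seminorm smul K (\<lambda>k. f k + smul a (g k)) \<ge> w_seminorm smul K f)"

definition nr_left_symmetric ::
    "('k::real_or_complex \<Rightarrow> 'x::banach \<Rightarrow> 'x) \<Rightarrow> 'x set \<Rightarrow> ('x \<Rightarrow> 'x) \<Rightarrow> bool" where
  "nr_left_symmetric smul K f \<longleftrightarrow>
     (\<forall>g. continuous_on K g \<longrightarrow> w_orthogonal smul K f g \<longrightarrow> w_orthogonal smul K g f)"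

end

theory Submission imports Defs begin

text \<open>
  Write \<open>v k\<close> for the seminorm \<open>v_seminorm smul k\<close> and \<open>w\<close> for \<open>w_seminorm smul K\<close>, so that
  \<open>w g\<close> is the supremum of \<open>v k (g k)\<close> over \<open>k \<in> K\<close>. The proof rests on one analytic fact: \<open>v\<close> is
  jointly upper semicontinuous (\<open>v_upper_semicontinuous\<close>). Hence on a compact set the
  supremum defining \<open>w f\<close> is attained at some \<open>k0\<close> (\<open>w_attained\<close>).

  Let \<open>f\<close> be left symmetric and put \<open>g k = dist k k0 * f k\<close>. All functions \<open>f + a g\<close> agree with \<open>f\<close>
  at \<open>k0\<close>, where \<open>f\<close> attains its seminorm, so \<open>f\<close> is orthogonal to \<open>g\<close>. If \<open>v k (f k)\<close> were positive
  for some \<open>k \<noteq> k0\<close>, then \<open>w g > 0\<close>, and subtracting a small positive multiple of \<open>f\<close> from \<open>g\<close> would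
  decrease \<open>w g\<close>, contradicting that \<open>g\<close> is orthogonal to \<open>f\<close>. This gives condition (i)
  (\<open>left_symmetric_imp_null\<close>). For (ii), let \<open>f k0\<close> be orthogonal to \<open>y\<close>. A bump function at \<open>k0\<close>
  times \<open>y\<close> is a function \<open>g\<close> to which \<open>f\<close> is orthogonal, because \<open>w f = v k0 (f k0)\<close>, so \<open>g\<close> is orthogonal to \<open>f\<close>. Suppose now
  that \<open>v k0 (y + a f k0) < v k0 y\<close>. The danger is that \<open>w g\<close> could be approached at points other
  than \<open>k0\<close>, where adding \<open>a f\<close> changes nothing. But precisely because it changes nothing there,
  \<open>v k y = v k (y + a f k)\<close>, and semicontinuity keeps this below \<open>v k0 y\<close> near \<open>k0\<close>; so
  \<open>w (g + a f) < w g\<close> for a sufficiently narrow bump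
  (\<open>left_symmetric_imp_v_left_symmetric\<close>).

  Conversely, assume (i) and (ii), and let \<open>f\<close> be orthogonal to \<open>g\<close>. For small \<open>a\<close> the values of
  \<open>f + a g\<close> off \<open>k0\<close> are too small to matter, so \<open>f k0\<close> is orthogonal to \<open>g k0\<close> for small
  scalars, and by convexity for all scalars (\<open>v_orthogonal_local\<close>). By (ii) \<open>g k0\<close> is orthogonal
  to \<open>f k0\<close>, and adding multiples of \<open>f\<close> to \<open>g\<close> does not affect the seminorms at other points
  (\<open>nr_left_symmetricI\<close>).

  Semicontinuity comes from a Hahn-Banach criterion: if \<open>t + c \<le> norm (x + t u)\<close> for all \<open>t \<ge> 0\<close>,
  then some \<open>\<phi> \<in> J u\<close> has \<open>norm (\<phi> x) \<ge> c\<close> (\<open>ex_in_J\<close>). The inequalities on the left pass to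
  limits in \<open>u\<close> and \<open>x\<close>. The same criterion with \<open>x = 0\<close> shows that \<open>J u\<close> is nonempty, which makes \<open>v u\<close> a seminorm.
\<close>

section \<open>Sublinear functionals and the Hahn-Banach theorem\<close>

definition sublinear :: "('a::real_vector \<Rightarrow> real) \<Rightarrow> bool" where
  "sublinear q \<longleftrightarrow> (\<forall>x y. q (x + y) \<le> q x + q y) \<and> (\<forall>r x. 0 \<le> r \<longrightarrow> q (r *\<^sub>R x) \<le> r * q x)"

lemma sublinear_add: "sublinear q \<Longrightarrow> q (x + y) \<le> q x + q y"
  by (simp add: sublinear_def)

lemma sublinear_scaleR_le: "sublinear q \<Longrightarrow> 0 \<le> r \<Longrightarrow> q (r *\<^sub>R x) \<le> r * q x"
  by (simp add: sublinear_def)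

lemma sublinear_zero: "sublinear q \<Longrightarrow> q 0 = 0"
  using sublinear_add[of q 0 0] sublinear_scaleR_le[of q 0 0] by simp

lemma sublinear_scaleR:
  assumes "sublinear q" "0 \<le> r"
  shows "q (r *\<^sub>R x) = r * q x"
proof (cases "r = 0")
  case True
  then show ?thesis using sublinear_zero[OF assms(1)] by simp
next
  case False
  with assms have r: "r > 0" by simp
  have "q ((1/r) *\<^sub>R (r *\<^sub>R x)) \<le> (1/r) * q (r *\<^sub>R x)"
    by (rule sublinear_scaleR_le) (use assms r in auto)
  then have "r * q x \<le> q (r *\<^sub>R x)" using r by (simp add: field_simps)
  then show ?thesis using sublinear_scaleR_le[OF assms, of x] by simp
qed

lemma sublinear_neg_le: "sublinear q \<Longrightarrow> - q (- x) \<le> q x"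
  using sublinear_add[of q x "- x"] sublinear_zero[of q] by simp

lemma sublinear_norm: "sublinear (norm :: 'a::real_normed_vector \<Rightarrow> real)"
  by (simp add: sublinear_def norm_triangle_ineq)

text \<open>
  The largest functional below \<open>q\<close> among the sublinear ones whose value at \<open>- a\<close> is at most
  \<open>- c\<close>. A linear functional below it is therefore both dominated by \<open>q\<close> and at least \<open>c\<close> at \<open>a\<close>:
  tilting turns lower bounds into domination. The infimum is meaningful when \<open>c \<le> q a\<close>.
\<close>

definition tilt :: "('a::real_vector \<Rightarrow> real) \<Rightarrow> 'a \<Rightarrow> real \<Rightarrow> 'a \<Rightarrow> real" where
  "tilt q a c z = (INF t\<in>{0..}. q (z + t *\<^sub>R a) - t * c)"

context
  fixes q :: "'a::real_vector \<Rightarrow> real" and a :: 'a and c :: real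
  assumes q: "sublinear q" and c: "c \<le> q a"
begin

lemma tilt_le:
  assumes "0 \<le> t"
  shows "tilt q a c z \<le> q (z + t *\<^sub>R a) - t * c"
  unfolding tilt_def
proof (rule cINF_lower)
  show "bdd_below ((\<lambda>t. q (z + t *\<^sub>R a) - t * c) ` {0..})"
  proof (rule bdd_belowI2)
    fix t :: real assume "t \<in> {0..}"
    then have t: "0 \<le> t" by simp
    have "t * q a = q ((z + t *\<^sub>R a) + (- z))" using sublinear_scaleR[OF q t] by simp
    also have "\<dots> \<le> q (z + t *\<^sub>R a) + q (- z)" by (rule sublinear_add[OF q])
    finally show "- q (- z) \<le> q (z + t *\<^sub>R a) - t * c"
      using mult_left_mono[OF c t] by simp
  qed
qed (use assms in simp)

lemma le_tiltI: "(\<And>t. 0 \<le> t \<Longrightarrow> d \<le> q (z + t *\<^sub>R a) - t * c) \<Longrightarrow> d \<le> tilt q a c z"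
  unfolding tilt_def by (rule cINF_greatest) auto

lemma tilt_le_self: "tilt q a c z \<le> q z"
  using tilt_le[of 0 z] by simp

lemma tilt_uminus: "tilt q a c (- a) \<le> - c"
  using tilt_le[of 1 "- a"] sublinear_zero[OF q] by simp

lemma sublinear_tilt: "sublinear (tilt q a c)"
  unfolding sublinear_def
proof (intro conjI allI impI)
  fix x y
  have "tilt q a c (x + y) - (q (y + s *\<^sub>R a) - s * c) \<le> tilt q a c x" if s: "0 \<le> s" for s
  proof (rule le_tiltI)
    fix t :: real assume t: "0 \<le> t"
    have "tilt q a c (x + y) \<le> q ((x + t *\<^sub>R a) + (y + s *\<^sub>R a)) - (t + s) * c"
      using tilt_le[of "t + s" "x + y"] s t by (simp add: algebra_simps)
    then show "tilt q a c (x + y) - (q (y + s *\<^sub>R a) - s * c) \<le> q (x + t *\<^sub>R a) - t * c"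
      using sublinear_add[OF q, of "x + t *\<^sub>R a" "y + s *\<^sub>R a"] by (simp add: algebra_simps)
  qed
  then have "tilt q a c (x + y) - tilt q a c x \<le> tilt q a c y"
    by (intro le_tiltI) (simp add: algebra_simps)
  then show "tilt q a c (x + y) \<le> tilt q a c x + tilt q a c y" by simp
next
  fix r :: real and x assume r: "0 \<le> r"
  have *: "tilt q a c (r *\<^sub>R x) \<le> r * (q (x + t *\<^sub>R a) - t * c)" if "0 \<le> t" for t
    using tilt_le[of "r * t" "r *\<^sub>R x"] sublinear_scaleR[OF q r, of "x + t *\<^sub>R a"] r that
    by (simp add: algebra_simps)
  show "tilt q a c (r *\<^sub>R x) \<le> r * tilt q a c x"
  proof (cases "r = 0")
    case True
    then show ?thesis using *[of 0] by simp
  next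
    case False
    with r have "r > 0" by simp
    have "tilt q a c (r *\<^sub>R x) / r \<le> tilt q a c x"
      using * \<open>r > 0\<close> by (intro le_tiltI) (simp add: field_simps)
    then show ?thesis using \<open>r > 0\<close> by (simp add: field_simps)
  qed
qed

end

text \<open>
  Zorn's lemma applies because the pointwise infimum of a chain of sublinear functionals below \<open>p\<close>
  is again one: each of them is bounded below by \<open>- p (- z)\<close> at \<open>z\<close>.
\<close>

lemma ex_minimal_sublinear:
  assumes p: "sublinear p"
  shows "\<exists>q. sublinear q \<and> q \<le> p \<and> (\<forall>r. sublinear r \<longrightarrow> r \<le> q \<longrightarrow> r = q)"
proof -
  define A where "A = {q. sublinear q \<and> q \<le> p}"
  have "\<exists>m\<in>A. \<forall>a\<in>A. m \<ge> a \<longrightarrow> a = m"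
  proof (rule predicate_Zorn)
    show "partial_order_on A (relation_of (\<lambda>x y. x \<ge> y) A)"
      by (auto simp: partial_order_on_def preorder_on_def refl_on_def trans_def antisym_def
          relation_of_def)
  next
    fix C assume C: "C \<in> Chains (relation_of (\<lambda>x y. x \<ge> y) A)"
    then have CA: "\<And>q. q \<in> C \<Longrightarrow> q \<in> A" and tot: "\<And>q r. q \<in> C \<Longrightarrow> r \<in> C \<Longrightarrow> q \<le> r \<or> r \<le> q"
      by (auto simp: Chains_def relation_of_def)
    show "\<exists>u\<in>A. \<forall>q\<in>C. q \<ge> u"
    proof (cases "C = {}")
      case True
      then show ?thesis using p by (auto simp: A_def)
    next
      case False
      define m where "m z = (INF q\<in>C. q z)" for z
      have m_le: "m z \<le> q z" if "q \<in> C" for q z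
        unfolding m_def
      proof (rule cINF_lower[OF _ that], rule bdd_belowI2)
        fix r assume "r \<in> C"
        then have "sublinear r" "r \<le> p" using CA by (auto simp: A_def)
        then show "- p (- z) \<le> r z"
          using sublinear_neg_le[of r z] le_funD[of r p "- z"] by linarith
      qed
      have le_m: "d \<le> m z" if "\<And>q. q \<in> C \<Longrightarrow> d \<le> q z" for d z
        unfolding m_def using False that by (intro cINF_greatest) auto
      have sub: "sublinear m" unfolding sublinear_def
      proof (intro conjI allI impI)
        fix x y
        have "m (x + y) - r y \<le> m x" if r: "r \<in> C" for r
        proof (rule le_m)
          fix q assume q: "q \<in> C"
          \<comment> \<open>In a chain the smaller of two functionals serves for both arguments.\<close>
          obtain s where s: "s \<in> C" "s \<le> q" "s \<le> r" using tot[OF q r] q r by blast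
          have "m (x + y) \<le> s x + s y"
            using m_le[OF s(1), of "x + y"] CA[OF s(1)] sublinear_add[of s x y]
            by (auto simp: A_def)
          also have "\<dots> \<le> q x + r y" using s by (auto simp: le_fun_def intro: add_mono)
          finally show "m (x + y) - r y \<le> q x" by simp
        qed
        then have "m (x + y) - m x \<le> m y" by (intro le_m) (simp add: algebra_simps)
        then show "m (x + y) \<le> m x + m y" by simp
      next
        fix r :: real and x assume r: "0 \<le> r"
        have *: "m (r *\<^sub>R x) \<le> r * q x" if "q \<in> C" for q
          using m_le[OF that, of "r *\<^sub>R x"] CA[OF that] sublinear_scaleR[OF _ r, of q x]
          by (auto simp: A_def)
        show "m (r *\<^sub>R x) \<le> r * m x"
        proof (cases "r = 0")
          case True
          then show ?thesis using * False by auto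
        next
          case F: False
          with r have "r > 0" by simp
          have "m (r *\<^sub>R x) / r \<le> m x"
            using * \<open>r > 0\<close> by (intro le_m) (simp add: field_simps)
          then show ?thesis using \<open>r > 0\<close> by (simp add: field_simps)
        qed
      qed
      obtain q where q: "q \<in> C" using False by blast
      have "m \<le> p" using m_le[OF q] CA[OF q] by (auto simp: A_def le_fun_def intro: order_trans)
      then show ?thesis using sub m_le by (auto simp: A_def le_fun_def)
    qed
  qed
  then obtain m where "m \<in> A" and m: "\<And>a. a \<in> A \<Longrightarrow> a \<le> m \<Longrightarrow> a = m" by blast
  then show ?thesis unfolding A_def by (intro exI[of _ m]) (auto intro: order_trans)
qed

text \<open>
  Hahn-Banach: a minimal sublinear functional \<open>q\<close> equals its tilt \<open>tilt q a (q a)\<close> for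
  every \<open>a\<close>, and this forces \<open>q (x + a) \<ge> q x + q a\<close>, so \<open>q\<close> is linear.
\<close>

lemma linear_below_sublinear:
  assumes "sublinear p"
  shows "\<exists>\<psi>. linear \<psi> \<and> (\<forall>x. \<psi> x \<le> p x)"
proof -
  obtain q where q: "sublinear q" and qp: "q \<le> p"
    and min: "\<And>r. sublinear r \<Longrightarrow> r \<le> q \<Longrightarrow> r = q"
    using ex_minimal_sublinear[OF assms] by blast
  have add: "q (x + y) = q x + q y" for x y
  proof -
    have "tilt q y (q y) = q"
      using sublinear_tilt[OF q order_refl] tilt_le_self[OF q order_refl]
      by (intro min) (auto simp: le_fun_def)
    then have "q x \<le> q (x + y) - q y"
      using tilt_le[OF q order_refl, of 1 y x] by simp
    then show ?thesis using sublinear_add[OF q, of x y] by simp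
  qed
  have neg: "q (- x) = - q x" for x using add[of x "- x"] sublinear_zero[OF q] by simp
  have "q (r *\<^sub>R x) = r * q x" for r x
  proof (cases "r \<ge> 0")
    case True then show ?thesis by (rule sublinear_scaleR[OF q])
  next
    case False
    then show ?thesis using sublinear_scaleR[OF q, of "- r" x] neg[of "r *\<^sub>R x"] by simp
  qed
  then have "linear q" using add by (intro linearI) auto
  then show ?thesis using qp by (auto simp: le_fun_def)
qed

text \<open>
  The two lower bounds \<open>\<psi> u \<ge> 1\<close> and \<open>\<psi> x \<ge> c\<close> are imposed by tilting the norm twice. The
  assumption on \<open>x\<close> says exactly that the norm tilted at \<open>u\<close> is still at least \<open>c\<close> at \<open>x\<close>, which is
  what the second tilt requires.
\<close>

lemma supporting_functional:
  fixes u x :: "'a::real_normed_vector"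
  assumes u: "norm u = 1" and x: "\<And>t. 0 \<le> t \<Longrightarrow> t + c \<le> norm (x + t *\<^sub>R u)"
  shows "\<exists>\<psi>. linear \<psi> \<and> (\<forall>z. \<psi> z \<le> norm z) \<and> \<psi> u = 1 \<and> c \<le> \<psi> x"
proof -
  define p where "p = tilt norm u 1"
  have u': "1 \<le> norm u" using u by simp
  have p: "sublinear p" unfolding p_def by (rule sublinear_tilt[OF sublinear_norm u'])
  have c: "c \<le> p x" unfolding p_def
    by (rule le_tiltI[OF sublinear_norm u']) (use x in \<open>simp add: algebra_simps\<close>)
  obtain \<psi> where \<psi>: "linear \<psi>" "\<And>z. \<psi> z \<le> tilt p x c z"
    using linear_below_sublinear[OF sublinear_tilt[OF p c]] by blast
  have le_p: "\<psi> z \<le> p z" for z using \<psi>(2)[of z] tilt_le_self[OF p c, of z] by simp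
  have le_norm: "\<psi> z \<le> norm z" for z
    using le_p[of z] tilt_le_self[OF sublinear_norm u', of z] by (simp add: p_def)
  have "- \<psi> u \<le> - 1"
    using le_p[of "- u"] tilt_uminus[OF sublinear_norm u'] linear_neg[OF \<psi>(1)] by (simp add: p_def)
  then have "\<psi> u = 1" using le_norm[of u] u by simp
  moreover have "c \<le> \<psi> x"
    using \<psi>(2)[of "- x"] tilt_uminus[OF p c] linear_neg[OF \<psi>(1)] by simp
  ultimately show ?thesis using \<psi>(1) le_norm by blast
qed

section \<open>The scalar field\<close>

text \<open>
  Additivity and multiplicativity force the embedding to fix the rationals; being an isometry,
  it then fixes all reals, so it is real-linear.
\<close>

lemma scalar_embedding:
  obtains h :: "'k::real_or_complex \<Rightarrow> complex" where
    "bounded_linear h" "\<And>a b. h (a * b) = h a * h b" "\<And>a. norm (h a) = norm a"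
    "\<And>r. h (of_real r) = of_real r" "range h = \<real> \<or> range h = UNIV"
proof -
  obtain h :: "'k \<Rightarrow> complex" where add: "\<And>a b. h (a + b) = h a + h b"
    and mult: "\<And>a b. h (a * b) = h a * h b" and nrm: "\<And>a. norm (h a) = norm a"
    and rng: "range h = \<real> \<or> range h = UNIV"
    using ex_isometric_embedding[where 'a = 'k] by blast
  have h0: "h 0 = 0" using add[of 0 0] by simp
  have h1: "h 1 = 1" using mult[of 1 1] nrm[of 1] by (metis mult_cancel_left1 norm_zero norm_one zero_neq_one)
  have hneg: "h (- a) = - h a" for a using add[of a "- a"] h0 by (simp add: eq_neg_iff_add_eq_0 add.commute)
  have hdiff: "h (a - b) = h a - h b" for a b using add[of a "- b"] hneg by simp
  have hnat: "h (of_nat n) = of_nat n" for n by (induction n) (auto simp: h0 h1 add)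
  have hint: "h (of_int m) = of_int m" for m
    by (cases m rule: int_cases2) (auto simp: hnat hneg)
  have hrat: "h (of_real (of_rat s)) = of_real (of_rat s)" for s :: rat
  proof (cases s)
    case (Fract m n)
    then have n: "n \<noteq> 0" by simp
    have s: "(of_rat s :: real) = of_int m / of_int n" using Fract by (simp add: of_rat_rat)
    have "h (of_real (of_rat s)) * h (of_int n) = h (of_int m)"
      unfolding mult[symmetric] using n by (simp add: s)
    then show ?thesis using n by (simp add: s hint field_simps)
  qed
  have hreal: "h (of_real r) = of_real r" for r
  proof -
    have "norm (h (of_real r) - of_real r) \<le> 0 + e" if e: "e > 0" for e
    proof -
      obtain s where s: "r < of_rat s" "of_rat s < r + e / 2"
        using of_rat_dense[of r "r + e/2"] e by auto
      have "norm (h (of_real r) - of_real (of_rat s)) = norm (h (of_real (r - of_rat s)))"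
        by (simp add: hdiff hrat)
      also have "\<dots> = \<bar>r - of_rat s\<bar>" by (simp only: nrm norm_of_real)
      finally have 1: "norm (h (of_real r) - of_real (of_rat s)) \<le> e / 2" using s by simp
      have "norm (of_real (of_rat s) - of_real r :: complex) = \<bar>of_rat s - r\<bar>"
        by (metis norm_of_real of_real_diff)
      then have 2: "norm (of_real (of_rat s) - of_real r :: complex) \<le> e / 2" using s by simp
      show ?thesis using norm_diff_triangle_le[OF 1 2] by simp
    qed
    then have "norm (h (of_real r) - of_real r) \<le> 0" by (rule field_le_epsilon)
    then show ?thesis by simp
  qed
  have "bounded_linear h"
  proof (rule bounded_linear_intro[where K = 1])
    show "h (r *\<^sub>R a) = r *\<^sub>R h a" for r a
      by (simp add: scaleR_conv_of_real mult hreal)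
  qed (simp_all add: add nrm)
  then show ?thesis using that mult nrm hreal rng by blast
qed

lemma compact_scalar_sphere: "compact (sphere (0::'k::real_or_complex) 1)"
proof -
  obtain h :: "'k \<Rightarrow> complex" where lin: "bounded_linear h" and nrm: "\<And>a. norm (h a) = norm a"
    and rng: "range h = \<real> \<or> range h = UNIV"
    using scalar_embedding by metis
  interpret h: bounded_linear h by (rule lin)
  have inj: "inj h" by (rule injI) (metis h.diff nrm norm_eq_zero right_minus_eq)
  have "closed (range h)" using rng by (auto simp: closed_complex_Reals)
  then have cpt: "compact (sphere 0 1 \<inter> range h)" by (intro compact_Int_closed) auto
  have "1-lipschitz_on (range h) (inv h)"
  proof (rule lipschitz_onI)
    fix z w assume "z \<in> range h" "w \<in> range h"
    then obtain a b where "z = h a" "w = h b" by blast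
    then show "dist (inv h z) (inv h w) \<le> 1 * dist z w"
      using inj nrm[of "a - b"] by (simp add: dist_norm h.diff)
  qed simp
  then have "continuous_on (range h) (inv h)" by (rule lipschitz_on_continuous_on)
  then have "compact (inv h ` (sphere 0 1 \<inter> range h))"
    by (intro compact_continuous_image[OF _ cpt]) (auto intro: continuous_on_subset)
  moreover have "inv h ` (sphere 0 1 \<inter> range h) = sphere 0 1"
  proof (intro equalityI subsetI)
    fix a :: 'k assume "a \<in> sphere 0 1"
    then have "h a \<in> sphere 0 1 \<inter> range h" "a = inv h (h a)" using nrm inj by auto
    then show "a \<in> inv h ` (sphere 0 1 \<inter> range h)" by blast
  qed (use inj nrm in auto)
  ultimately show ?thesis by simp
qed

lemma ex_scalar_rotation: "\<exists>b::'k::real_normed_field. norm b = 1 \<and> b * z = of_real (norm z)"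
proof (cases "z = 0")
  case True
  then show ?thesis by (intro exI[of _ 1]) simp
next
  case False
  then show ?thesis by (intro exI[of _ "of_real (norm z) / z"]) (simp add: norm_divide)
qed

section \<open>The seminorm of a point of the unit sphere\<close>

context banach_space_over
begin

text \<open>
  A real-linear functional is the real part of a \<open>'k\<close>-linear one. For real scalars there is
  nothing to do; for complex scalars with imaginary unit \<open>j\<close> the functional is
  \<open>\<psi> x - \<psi> (j x) j\<close>. The norm bound carries over because a rotation of \<open>x\<close> makes the value
  of \<open>\<phi>\<close> real and nonnegative.
\<close>

lemma dual_space_from_real:
  fixes h :: "'k \<Rightarrow> complex"
  assumes h: "bounded_linear h" "\<And>a b. h (a * b) = h a * h b" "\<And>a. norm (h a) = norm a"
    "\<And>r. h (of_real r) = of_real r" "range h = \<real> \<or> range h = UNIV"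
    and \<psi>: "linear \<psi>" "\<And>z. \<psi> z \<le> norm z"
  shows "\<exists>\<phi>\<in>dual_space smul. (\<forall>x. Re (h (\<phi> x)) = \<psi> x) \<and> (\<forall>x. norm (\<phi> x) \<le> norm x)"
proof -
  interpret h: bounded_linear h by (rule h)
  have inj: "inj h" by (rule injI) (metis h.diff h(3) norm_eq_zero right_minus_eq)
  obtain \<phi> :: "'x \<Rightarrow> 'k" where add: "\<And>x y. \<phi> (x + y) = \<phi> x + \<phi> y"
    and mult: "\<And>a x. \<phi> (smul a x) = a * \<phi> x" and Re: "\<And>x. Re (h (\<phi> x)) = \<psi> x"
  proof -
    consider "range h = \<real>" | "range h = UNIV" using h(5) by blast
    then show thesis
    proof cases
      case 1
      have *: "\<exists>r. a = of_real r" for a :: 'k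
      proof -
        obtain r where "h a = of_real r" using 1 by (metis Reals_cases rangeI)
        then have "a = of_real r" using h(4) inj by (metis injD)
        then show ?thesis by blast
      qed
      show thesis
      proof
        show "of_real (\<psi> (smul a x)) = a * of_real (\<psi> x)" for a x
          using *[of a] by (auto simp: smul_of_real linear_scale[OF \<psi>(1)])
      qed (simp_all add: linear_add[OF \<psi>(1)] h(4))
    next
      case 2
      then obtain j where j: "h j = \<i>" by (metis surjD)
      have jj: "j * j = - 1"
        by (rule injD[OF inj]) (simp add: h(2) j h.neg h(4)[of 1, simplified])
      have dec: "\<exists>r s. a = of_real r + of_real s * j" for a :: 'k
      proof -
        have "h a = h (of_real (Re (h a)) + of_real (Im (h a)) * j)"
          using complex_eq[of "h a"] by (simp add: h.add h(2) h(4) j mult.commute)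
        then show ?thesis using inj by (metis injD)
      qed
      define \<phi> where "\<phi> x = of_real (\<psi> x) - of_real (\<psi> (smul j x)) * j" for x
      have jjx: "smul j (smul j x) = - x" for x by (simp add: jj)
      show thesis
      proof (rule that[of \<phi>])
        show add: "\<phi> (x + y) = \<phi> x + \<phi> y" for x y
          by (simp add: \<phi>_def scale_right_distrib linear_add[OF \<psi>(1)] algebra_simps)
        have real: "\<phi> (smul (of_real r) x) = of_real r * \<phi> x" for r x
        proof -
          have "smul j (r *\<^sub>R x) = r *\<^sub>R smul j x"
            by (metis mult.commute scale_scale smul_of_real)
          then show ?thesis
            by (simp add: \<phi>_def smul_of_real linear_scale[OF \<psi>(1)] algebra_simps)
        qed
        have im: "\<phi> (smul j x) = j * \<phi> x" for x
        proof -
          have "j * (of_real s * j) = - of_real s" for s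
            by (metis jj mult.left_commute mult_minus1_right)
          then show ?thesis
            unfolding \<phi>_def jjx by (simp add: linear_neg[OF \<psi>(1)] right_diff_distrib)
        qed
        show "\<phi> (smul a x) = a * \<phi> x" for a x
        proof -
          obtain r s where a: "a = of_real r + of_real s * j" using dec by blast
          have "\<phi> (smul a x) = \<phi> (smul (of_real r) x + smul (of_real s) (smul j x))"
            by (simp only: a scale_left_distrib scale_scale)
          then show ?thesis by (simp only: add real im a) (simp add: algebra_simps)
        qed
        show "Re (h (\<phi> x)) = \<psi> x" for x by (simp add: \<phi>_def h.diff h(2) h(4) j)
      qed
    qed
  qed
  have bound: "norm (\<phi> x) \<le> norm x" for x
  proof -
    obtain b where b: "norm b = 1" "b * \<phi> x = of_real (norm (\<phi> x))"
      using ex_scalar_rotation by blast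
    have "norm (\<phi> x) = Re (h (\<phi> (smul b x)))" by (simp add: mult b h(4))
    also have "\<dots> \<le> norm (smul b x)" by (simp add: Re \<psi>(2))
    finally show ?thesis by (simp add: norm_smul b)
  qed
  have "bounded_linear \<phi>"
  proof (rule bounded_linear_intro[where K = 1])
    show "\<phi> (r *\<^sub>R x) = r *\<^sub>R \<phi> x" for r x
      using mult[of "of_real r" x] by (simp add: smul_of_real scaleR_conv_of_real)
  qed (simp_all add: add bound)
  then show ?thesis using mult Re bound unfolding dual_space_def by blast
qed

text \<open>
  Norm inequalities along the ray from \<open>x\<close> in direction \<open>u\<close> produce a member of \<open>J smul u\<close> that is
  large at \<open>x\<close>. In the opposite direction, any \<open>\<phi> \<in> J smul u\<close> with \<open>\<phi> x = of_real c\<close> yields these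
  inequalities, since \<open>\<phi> (x + t u) = of_real (c + t)\<close>; this is how membership in \<open>J\<close> is transported
  to limit points.
\<close>

lemma ex_in_J:
  assumes u: "norm u = 1" and x: "\<And>t. 0 \<le> t \<Longrightarrow> t + c \<le> norm (x + t *\<^sub>R u)"
  shows "\<exists>\<phi>\<in>J smul u. c \<le> norm (\<phi> x)"
proof -
  obtain h :: "'k \<Rightarrow> complex" where h: "bounded_linear h" "\<And>a b. h (a * b) = h a * h b"
    "\<And>a. norm (h a) = norm a" "\<And>r. h (of_real r) = of_real r" "range h = \<real> \<or> range h = UNIV"
    using scalar_embedding by metis
  obtain \<psi> where \<psi>: "linear \<psi>" "\<And>z. \<psi> z \<le> norm z" "\<psi> u = 1" "c \<le> \<psi> x"
    using supporting_functional[OF u x] by blast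
  obtain \<phi> where \<phi>: "\<phi> \<in> dual_space smul" "\<And>x. Re (h (\<phi> x)) = \<psi> x"
      "\<And>x. norm (\<phi> x) \<le> norm x"
    using dual_space_from_real[OF h \<psi>(1,2)] by blast
  \<comment> \<open>A complex number of modulus at most 1 whose real part is 1 equals 1.\<close>
  have "norm (h (\<phi> u)) \<le> 1" "Re (h (\<phi> u)) = 1"
    using \<phi>(2,3)[of u] u \<psi>(3) by (simp_all add: h(3))
  then have "(norm (h (\<phi> u)))\<^sup>2 \<le> 1" "Re (h (\<phi> u)) = 1" by (simp_all add: power_le_one)
  then have "h (\<phi> u) = 1" by (simp add: cmod_power2 complex_eq_iff)
  then have "h (\<phi> u - 1) = 0" using h(4)[of 1] linear_diff[OF bounded_linear.linear[OF h(1)]] by simp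
  then have \<phi>u: "\<phi> u = 1" using h(3)[of "\<phi> u - 1"] by simp
  have bl: "bounded_linear \<phi>" using \<phi>(1) by (simp add: dual_space_def)
  have "onorm \<phi> \<le> 1" by (rule onorm_bound) (use \<phi>(3) in simp_all)
  moreover have "1 \<le> onorm \<phi>" using onorm[OF bl, of u] u \<phi>u by simp
  ultimately have "\<phi> \<in> J smul u" using \<phi>(1) \<phi>u by (simp add: J_def)
  moreover have "c \<le> norm (\<phi> x)"
    using \<psi>(4) abs_Re_le_cmod[of "h (\<phi> x)"] by (simp add: \<phi>(2) h(3))
  ultimately show ?thesis by blast
qed

lemma J_nonempty: "norm u = 1 \<Longrightarrow> J smul u \<noteq> {}"
  using ex_in_J[of u 0 0] by auto

lemma
  assumes "\<phi> \<in> J smul u"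
  shows J_add: "\<phi> (x + y) = \<phi> x + \<phi> y"
    and J_smul: "\<phi> (smul a x) = a * \<phi> x"
    and J_self: "\<phi> u = 1"
    and J_bound: "norm (\<phi> x) \<le> norm x"
proof -
  have "bounded_linear \<phi>" using assms by (simp add: J_def dual_space_def)
  then show "\<phi> (x + y) = \<phi> x + \<phi> y" "norm (\<phi> x) \<le> norm x"
    using onorm[of \<phi> x] assms by (simp_all add: J_def linear_add bounded_linear.linear)
qed (use assms in \<open>simp_all add: J_def dual_space_def\<close>)

lemma norm_le_v: "\<phi> \<in> J smul u \<Longrightarrow> norm (\<phi> x) \<le> v_seminorm smul u x"
  unfolding v_seminorm_def by (rule cSUP_upper) (auto intro!: bdd_aboveI2 J_bound)

lemma v_le:
  "norm u = 1 \<Longrightarrow> (\<And>\<phi>. \<phi> \<in> J smul u \<Longrightarrow> norm (\<phi> x) \<le> c) \<Longrightarrow> v_seminorm smul u x \<le> c"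
  unfolding v_seminorm_def by (rule cSUP_least) (use J_nonempty in auto)

lemma v_nonneg: "norm u = 1 \<Longrightarrow> 0 \<le> v_seminorm smul u x"
  using J_nonempty[of u] norm_le_v[of _ u x] norm_ge_zero order_trans by blast

lemma v_triangle:
  assumes "norm u = 1"
  shows "v_seminorm smul u (x + y) \<le> v_seminorm smul u x + v_seminorm smul u y"
proof (rule v_le[OF assms])
  fix \<phi> assume \<phi>: "\<phi> \<in> J smul u"
  show "norm (\<phi> (x + y)) \<le> v_seminorm smul u x + v_seminorm smul u y"
    unfolding J_add[OF \<phi>] using norm_le_v[OF \<phi>, of x] norm_le_v[OF \<phi>, of y]
    by (intro norm_triangle_le) simp
qed

lemma v_smul:
  assumes u: "norm u = 1"
  shows "v_seminorm smul u (smul a x) = norm a * v_seminorm smul u x"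
proof (rule antisym)
  show "v_seminorm smul u (smul a x) \<le> norm a * v_seminorm smul u x"
    by (rule v_le[OF u]) (auto simp: J_smul norm_mult intro: mult_left_mono norm_le_v)
next
  show "norm a * v_seminorm smul u x \<le> v_seminorm smul u (smul a x)"
  proof (cases "a = 0")
    case True
    then show ?thesis using v_nonneg[OF u, of "smul a x"] by simp
  next
    case False
    have "v_seminorm smul u x \<le> v_seminorm smul u (smul a x) / norm a"
    proof (rule v_le[OF u])
      fix \<phi> assume \<phi>: "\<phi> \<in> J smul u"
      show "norm (\<phi> x) \<le> v_seminorm smul u (smul a x) / norm a"
        using norm_le_v[OF \<phi>, of "smul a x"] False
        by (simp add: J_smul[OF \<phi>] norm_mult field_simps)
    qed
    then show ?thesis using False by (simp add: field_simps)
  qed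
qed

lemma v_add_null:
  assumes u: "norm u = 1" and y: "v_seminorm smul u y = 0"
  shows "v_seminorm smul u (x + smul a y) = v_seminorm smul u x"
proof (rule antisym)
  show "v_seminorm smul u (x + smul a y) \<le> v_seminorm smul u x"
    using v_triangle[OF u, of x "smul a y"] v_smul[OF u, of a y] y by simp
  show "v_seminorm smul u x \<le> v_seminorm smul u (x + smul a y)"
    using v_triangle[OF u, of "x + smul a y" "smul (- a) y"] v_smul[OF u, of "- a" y] y by simp
qed

text \<open>
  By convexity of \<open>\<lambda>a. v_seminorm smul u (x + smul a y)\<close>, a local minimum at \<open>0\<close> is global.
\<close>

lemma v_orthogonal_local:
  assumes u: "norm u = 1" and \<delta>: "0 < \<delta>"
    and loc: "\<And>a :: 'k. norm a < \<delta> \<Longrightarrow> v_seminorm smul u x \<le> v_seminorm smul u (x + smul a y)"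
  shows "v_orthogonal smul u x y"
  unfolding v_orthogonal_def
proof
  fix a :: 'k
  \<comment> \<open>The factor \<open>s\<close> pulls \<open>a\<close> into the ball of radius \<open>\<delta>\<close>.\<close>
  define s where "s = \<delta> / (norm a + \<delta>)"
  have pos: "norm a + \<delta> > 0" using \<delta> norm_ge_zero[of a] by linarith
  have s: "0 < s" "s \<le> 1" using \<delta> pos by (simp_all add: s_def)
  have "s * norm a < \<delta>"
    using \<delta> pos by (simp add: s_def divide_less_eq)
  then have small: "norm (of_real s * a) < \<delta>" using s by (simp add: norm_mult)
  have "x + smul (of_real s * a) y
      = smul (of_real (1 - s)) x + smul (of_real s) (x + smul a y)"
    by (simp add: scale_right_distrib scale_left_diff_distrib)
  then have "v_seminorm smul u x
      \<le> v_seminorm smul u (smul (of_real (1 - s)) x) + v_seminorm smul u (smul (of_real s) (x + smul a y))"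
    using loc[OF small] v_triangle[OF u] by (metis order_trans)
  also have "\<dots> = (1 - s) * v_seminorm smul u x + s * v_seminorm smul u (x + smul a y)"
    using s unfolding v_smul[OF u] norm_of_real by simp
  finally have "s * v_seminorm smul u x \<le> s * v_seminorm smul u (x + smul a y)"
    by (simp add: algebra_simps)
  then show "v_seminorm smul u x \<le> v_seminorm smul u (x + smul a y)" using s by simp
qed

lemma bounded_bilinear_smul: "bounded_bilinear smul"
proof
  show "smul (r *\<^sub>R a) x = r *\<^sub>R smul a x" for r a x
    by (metis scaleR_conv_of_real scale_scale smul_of_real)
  show "smul a (r *\<^sub>R x) = r *\<^sub>R smul a x" for r a x
    by (metis mult.commute scale_scale smul_of_real)
  show "\<exists>C. \<forall>a x. norm (smul a x) \<le> norm a * norm x * C"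
    by (rule exI[of _ 1]) (simp add: norm_smul)
qed (simp_all add: scale_left_distrib scale_right_distrib)

lemmas continuous_on_smul [continuous_intros] =
  bounded_bilinear.continuous_on[OF bounded_bilinear_smul]

text \<open>
  Functionals \<open>\<phi> n \<in> J smul (k n)\<close> almost attaining the seminorms, multiplied by unit scalars \<open>b n\<close>
  that make \<open>\<phi> n (x n)\<close> nonnegative, give \<open>t + c n \<le> norm (b n x n + t k n)\<close> for all \<open>t \<ge> 0\<close>.
  Along a subsequence the \<open>b n\<close> converge to a unit scalar \<open>a\<close>, the inequalities pass to the limit,
  and \<open>ex_in_J\<close> yields a member of \<open>J smul k0\<close> that is large at \<open>a x0\<close>, hence at \<open>x0\<close>.
\<close>

lemma v_upper_semicontinuous:
  assumes k: "\<And>n. norm (k n) = 1" and k_lim: "k \<longlonglongrightarrow> k0" and x_lim: "x \<longlonglongrightarrow> x0"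
    and c_lim: "c \<longlonglongrightarrow> c0" and less: "\<And>n. c n < v_seminorm smul (k n) (x n)"
  shows "c0 \<le> v_seminorm smul k0 x0"
proof (rule ccontr)
  assume "\<not> c0 \<le> v_seminorm smul k0 x0"
  then have v_less: "v_seminorm smul k0 x0 < c0" by simp
  have k0: "norm k0 = 1" using tendsto_norm[OF k_lim] by (simp add: k LIMSEQ_const_iff)
  have "\<exists>\<phi>\<in>J smul (k n). c n < norm (\<phi> (x n))" for n
    using v_le[OF k, of n "x n" "c n"] less[of n] by force
  then obtain \<phi> where \<phi>: "\<And>n. \<phi> n \<in> J smul (k n)" "\<And>n. c n < norm (\<phi> n (x n))" by metis
  have "\<forall>n. \<exists>b. norm b = 1 \<and> b * \<phi> n (x n) = of_real (norm (\<phi> n (x n)))"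
    using ex_scalar_rotation by blast
  from choice[OF this] obtain b where b: "\<And>n. norm (b n) = 1"
      "\<And>n. b n * \<phi> n (x n) = of_real (norm (\<phi> n (x n)))"
    by blast
  have "\<forall>n. b n \<in> sphere 0 1" by (simp add: b(1))
  then obtain a r where a: "a \<in> sphere 0 1" "strict_mono r" "(b \<circ> r) \<longlonglongrightarrow> a"
    using compact_scalar_sphere unfolding compact_def by metis
  have "\<exists>t\<ge>0. norm (smul a x0 + t *\<^sub>R k0) < t + c0"
  proof (rule ccontr)
    assume "\<not> ?thesis"
    then have "\<And>t. 0 \<le> t \<Longrightarrow> t + c0 \<le> norm (smul a x0 + t *\<^sub>R k0)" by force
    from ex_in_J[OF k0 this] obtain \<psi> where \<psi>: "\<psi> \<in> J smul k0" "c0 \<le> norm (\<psi> (smul a x0))"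
      by blast
    then have "c0 \<le> norm (\<psi> x0)" using a(1) by (simp add: J_smul norm_mult)
    then show False using norm_le_v[OF \<psi>(1), of x0] v_less by simp
  qed
  then obtain t where t: "0 \<le> t" "norm (smul a x0 + t *\<^sub>R k0) < t + c0" by blast
  have "t + c n \<le> norm (smul (b n) (x n) + t *\<^sub>R k n)" for n
  proof -
    have "\<phi> n (smul (b n) (x n) + smul (of_real t) (k n)) = of_real (norm (\<phi> n (x n)) + t)"
      by (simp add: J_add[OF \<phi>(1)] J_smul[OF \<phi>(1)] J_self[OF \<phi>(1)] b(2))
    then have "norm (\<phi> n (smul (b n) (x n) + smul (of_real t) (k n))) = norm (\<phi> n (x n)) + t"
      using t(1) by (simp only: norm_of_real) simp
    then show ?thesis
      using J_bound[OF \<phi>(1), of n "smul (b n) (x n) + smul (of_real t) (k n)"] \<phi>(2)[of n]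
      by (simp add: smul_of_real)
  qed
  then have le: "t + (c \<circ> r) n \<le> norm (smul ((b \<circ> r) n) ((x \<circ> r) n) + t *\<^sub>R (k \<circ> r) n)" for n
    by simp
  have "t + c0 \<le> norm (smul a x0 + t *\<^sub>R k0)"
  proof (rule tendsto_le[OF sequentially_bot _ _ always_eventually[OF allI[OF le]]])
    show "(\<lambda>n. norm (smul ((b \<circ> r) n) ((x \<circ> r) n) + t *\<^sub>R (k \<circ> r) n))
        \<longlonglongrightarrow> norm (smul a x0 + t *\<^sub>R k0)"
      by (intro tendsto_intros bounded_bilinear.tendsto[OF bounded_bilinear_smul] a(3)
          LIMSEQ_subseq_LIMSEQ[OF x_lim a(2)] LIMSEQ_subseq_LIMSEQ[OF k_lim a(2)])
    show "(\<lambda>n. t + (c \<circ> r) n) \<longlonglongrightarrow> t + c0"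
      by (intro tendsto_intros LIMSEQ_subseq_LIMSEQ[OF c_lim a(2)])
  qed
  then show False using t(2) by simp
qed

lemma v_upper_semicontinuous_on:
  assumes K: "K \<subseteq> sphere 0 1" and g: "continuous_on K g" and k0: "k0 \<in> K"
    and less: "v_seminorm smul k0 (g k0) < c"
  shows "\<exists>e>0. \<forall>k\<in>K. dist k k0 < e \<longrightarrow> v_seminorm smul k (g k) \<le> c"
proof (rule ccontr)
  assume "\<not> ?thesis"
  then have "\<exists>k\<in>K. dist k k0 < inverse (real (Suc n)) \<and> c < v_seminorm smul k (g k)" for n
    by (metis not_less inverse_positive_iff_positive of_nat_0_less_iff zero_less_Suc)
  then obtain k where k: "\<And>n. k n \<in> K" "\<And>n. dist (k n) k0 < inverse (real (Suc n))"
      "\<And>n. c < v_seminorm smul (k n) (g (k n))" by metis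
  have "(\<lambda>n. dist (k n) k0) \<longlonglongrightarrow> 0"
    by (rule real_tendsto_sandwich[OF _ _ tendsto_const LIMSEQ_inverse_real_of_nat])
      (use k(2) in \<open>auto intro!: always_eventually less_imp_le\<close>)
  then have k_lim: "k \<longlonglongrightarrow> k0" by (rule tendsto_dist_iff[THEN iffD2])
  have g_lim: "(\<lambda>n. g (k n)) \<longlonglongrightarrow> g k0"
    using continuous_on_tendsto_compose[OF g k_lim k0] k(1) by simp
  have "norm (k n) = 1" for n using K k(1)[of n] by auto
  then have "c \<le> v_seminorm smul k0 (g k0)"
    by (rule v_upper_semicontinuous[OF _ k_lim g_lim tendsto_const k(3)])
  then show False using less by simp
qed

end

section \<open>The numerical-radius seminorm on a compact set\<close>

locale compact_in_sphere = banach_space_over smul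
  for smul :: "'k::real_or_complex \<Rightarrow> 'x::banach \<Rightarrow> 'x" +
  fixes K :: "'x set"
  assumes compact: "compact K" and nonempty: "K \<noteq> {}" and in_sphere: "K \<subseteq> sphere 0 1"
begin

abbreviation v :: "'x \<Rightarrow> 'x \<Rightarrow> real" where "v \<equiv> v_seminorm smul"
abbreviation w :: "('x \<Rightarrow> 'x) \<Rightarrow> real" where "w \<equiv> w_seminorm smul K"

lemma norm_eq_1: "k \<in> K \<Longrightarrow> norm k = 1"
  using in_sphere by auto

lemma v_le_w:
  assumes g: "continuous_on K g" and k: "k \<in> K"
  shows "v k (g k) \<le> w g"
proof (rule v_le[OF norm_eq_1[OF k]])
  fix \<phi> assume \<phi>: "\<phi> \<in> J smul k"
  obtain B where B: "\<And>k. k \<in> K \<Longrightarrow> norm (g k) \<le> B"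
    using compact_imp_bounded[OF compact_continuous_image[OF g compact]]
    by (auto simp: bounded_iff)
  have "bdd_above ((\<lambda>(k, \<phi>). norm (\<phi> (g k))) ` Pi_set smul K)"
    by (rule bdd_aboveI2[where M = B]) (auto simp: Pi_set_def intro: order_trans[OF J_bound B])
  then show "norm (\<phi> (g k)) \<le> w g"
    using cSUP_upper[of "(k, \<phi>)" "Pi_set smul K" "\<lambda>(k, \<phi>). norm (\<phi> (g k))"] k \<phi>
    by (simp add: w_seminorm_def Pi_set_def)
qed

lemma w_le:
  assumes "\<And>k. k \<in> K \<Longrightarrow> v k (g k) \<le> c"
  shows "w g \<le> c"
  unfolding w_seminorm_def
proof (rule cSUP_least)
  show "Pi_set smul K \<noteq> {}"
    using nonempty J_nonempty norm_eq_1 by (fastforce simp: Pi_set_def)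
qed (use assms in \<open>auto simp: Pi_set_def intro: order_trans[OF norm_le_v]\<close>)

lemma w_attained:
  assumes g: "continuous_on K g"
  shows "\<exists>k0\<in>K. v k0 (g k0) = w g"
proof -
  define c where "c n = w g - inverse (real (Suc n))" for n
  have "\<exists>k\<in>K. c n < v k (g k)" for n
    using w_le[of g "c n"] by (force simp: c_def)
  then obtain k where k: "\<And>n. k n \<in> K" "\<And>n. c n < v (k n) (g (k n))" by metis
  then obtain k0 r where k0: "k0 \<in> K" and r: "strict_mono r" and lim: "(k \<circ> r) \<longlonglongrightarrow> k0"
    using compact unfolding compact_def by metis
  have "c \<longlonglongrightarrow> w g - 0"
    unfolding c_def by (intro tendsto_diff tendsto_const LIMSEQ_inverse_real_of_nat)
  then have c: "(c \<circ> r) \<longlonglongrightarrow> w g" using LIMSEQ_subseq_LIMSEQ[OF _ r] by force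
  have g_lim: "(\<lambda>n. g ((k \<circ> r) n)) \<longlonglongrightarrow> g k0"
    using continuous_on_tendsto_compose[OF g lim k0] k(1) by simp
  have "w g \<le> v k0 (g k0)"
    by (rule v_upper_semicontinuous[OF _ lim g_lim c]) (use k norm_eq_1 in auto)
  then show ?thesis using v_le_w[OF g k0] k0 by force
qed

section \<open>Left symmetric functions\<close>

text \<open>
  The test function is \<open>g k = dist k k0 * f k\<close>. It vanishes at the point \<open>k0\<close> where \<open>f\<close> attains its
  seminorm, so \<open>f\<close> is orthogonal to it; but \<open>g\<close> is a nonnegative multiple of \<open>f\<close> at each point, and
  so, unless \<open>w g = 0\<close>, it is not orthogonal to \<open>f\<close>.
\<close>

lemma left_symmetric_imp_null:
  assumes sym: "nr_left_symmetric smul K f" and f: "continuous_on K f"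
    and k0: "k0 \<in> K" "v k0 (f k0) = w f" and k1: "k1 \<in> K" "k1 \<noteq> k0"
  shows "v k1 (f k1) = 0"
proof (rule ccontr)
  assume "v k1 (f k1) \<noteq> 0"
  then have v1: "0 < v k1 (f k1)" using v_nonneg[OF norm_eq_1[OF k1(1)], of "f k1"] by simp
  define g where "g k = smul (of_real (dist k k0)) (f k)" for k
  have g: "continuous_on K g" unfolding g_def by (intro continuous_intros f)
  have vg: "v k (g k) = dist k k0 * v k (f k)" if "k \<in> K" for k
    using v_smul[OF norm_eq_1[OF that], of "of_real (dist k k0)" "f k"] by (simp add: g_def)
  have "w_orthogonal smul K f g"
    unfolding w_orthogonal_def
  proof
    fix a
    have "continuous_on K (\<lambda>k. f k + smul a (g k))" by (intro continuous_intros f g)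
    from v_le_w[OF this k0(1)] show "w f \<le> w (\<lambda>k. f k + smul a (g k))"
      by (simp add: g_def k0(2))
  qed
  then have orth: "w_orthogonal smul K g f" using sym g by (simp add: nr_left_symmetric_def)
  have "0 < v k1 (g k1)" using v1 k1 by (simp add: vg)
  then have W: "0 < w g" using v_le_w[OF g k1(1)] by simp
  have M: "0 < w f" using v1 v_le_w[OF f k1(1)] by simp
  have dist_le: "dist k k0 \<le> 2" if "k \<in> K" for k
    using norm_triangle_ineq4[of k k0] norm_eq_1[OF that] norm_eq_1[OF k0(1)]
    by (simp add: dist_norm)
  have "w g \<le> 2 * w f"
  proof (rule w_le)
    fix k assume k: "k \<in> K"
    show "v k (g k) \<le> 2 * w f"
      unfolding vg[OF k]
      using dist_le[OF k] v_le_w[OF f k] v_nonneg[OF norm_eq_1[OF k]] by (intro mult_mono) auto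
  qed
  \<comment> \<open>Subtracting \<open>\<epsilon> f\<close> from \<open>g\<close> scales the values of \<open>g\<close> by \<open>1 - \<epsilon> / dist k k0\<close>, at most
    \<open>1 - \<epsilon> / 2\<close>, where \<open>dist k k0 > \<epsilon>\<close>, and leaves at most \<open>\<epsilon> * w f\<close> elsewhere.\<close>
  define \<epsilon> where "\<epsilon> = w g / (4 * w f)"
  have \<epsilon>: "0 < \<epsilon>" "\<epsilon> \<le> 1 / 2" and \<epsilon>M: "\<epsilon> * w f = w g / 4"
    using W M \<open>w g \<le> 2 * w f\<close> by (simp_all add: \<epsilon>_def field_simps)
  have "w (\<lambda>k. g k + smul (- of_real \<epsilon>) (f k)) \<le> w g * (1 - \<epsilon> / 2)"
  proof (rule w_le)
    fix k assume k: "k \<in> K"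
    define d where "d = dist k k0"
    have d: "0 \<le> d" "d \<le> 2" using dist_le[OF k] by (simp_all add: d_def)
    have v: "0 \<le> v k (f k)" by (rule v_nonneg[OF norm_eq_1[OF k]])
    have "g k + smul (- of_real \<epsilon>) (f k) = smul (of_real (d - \<epsilon>)) (f k)"
      by (simp add: g_def d_def scale_left_diff_distrib)
    then have eq: "v k (g k + smul (- of_real \<epsilon>) (f k)) = \<bar>d - \<epsilon>\<bar> * v k (f k)"
      using v_smul[OF norm_eq_1[OF k], of "of_real (d - \<epsilon>)" "f k"] by (simp only: norm_of_real)
    show "v k (g k + smul (- of_real \<epsilon>) (f k)) \<le> w g * (1 - \<epsilon> / 2)"
    proof (cases "d \<le> \<epsilon>")
      case True
      then have "\<bar>d - \<epsilon>\<bar> * v k (f k) \<le> \<epsilon> * w f"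
        using d \<epsilon> v v_le_w[OF f k] by (intro mult_mono) auto
      also have "\<dots> \<le> w g * (1 - \<epsilon> / 2)"
        unfolding \<epsilon>M using mult_left_mono[of "1 / 4" "1 - \<epsilon> / 2" "w g"] W \<epsilon> by simp
      finally show ?thesis by (simp only: eq)
    next
      case False
      have "\<bar>d - \<epsilon>\<bar> \<le> d * (1 - \<epsilon> / 2)"
        using False mult_right_mono[OF d(2), of \<epsilon>] \<epsilon> by (simp add: algebra_simps)
      then have "\<bar>d - \<epsilon>\<bar> * v k (f k) \<le> d * (1 - \<epsilon> / 2) * v k (f k)"
        using v by (rule mult_right_mono)
      also have "\<dots> = v k (g k) * (1 - \<epsilon> / 2)" by (simp add: vg[OF k] d_def)
      also have "\<dots> \<le> w g * (1 - \<epsilon> / 2)"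
        using v_le_w[OF g k] \<epsilon> by (intro mult_right_mono) auto
      finally show ?thesis by (simp only: eq)
    qed
  qed
  moreover have "w g \<le> w (\<lambda>k. g k + smul (- of_real \<epsilon>) (f k))"
    using orth by (simp only: w_orthogonal_def)
  moreover have "w g * (1 - \<epsilon> / 2) < w g" using W \<epsilon> by simp
  ultimately show False by simp
qed

text \<open>
  The test function is a bump at \<open>k0\<close> times \<open>y\<close>. Its width comes from semicontinuity of
  \<open>v k (y + smul a (f k))\<close>, which equals \<open>v k y\<close> for \<open>k \<noteq> k0\<close>: this keeps \<open>w g\<close> from being
  approached near \<open>k0\<close> but away from it.
\<close>

lemma left_symmetric_imp_v_left_symmetric:
  assumes sym: "nr_left_symmetric smul K f" and f: "continuous_on K f"
    and k0: "k0 \<in> K" "v k0 (f k0) = w f"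
    and null: "\<And>k. k \<in> K \<Longrightarrow> k \<noteq> k0 \<Longrightarrow> v k (f k) = 0"
  shows "v_left_symmetric smul k0 (f k0)"
  unfolding v_left_symmetric_def
proof (intro allI impI)
  fix y assume y: "v_orthogonal smul k0 (f k0) y"
  show "v_orthogonal smul k0 y (f k0)"
  proof (rule ccontr)
    assume "\<not> ?thesis"
    then obtain a where a: "v k0 (y + smul a (f k0)) < v k0 y"
      by (auto simp: v_orthogonal_def not_le)
    then obtain c where c: "v k0 (y + smul a (f k0)) < c" "c < v k0 y" using dense by blast
    have c0: "0 \<le> c" using c(1) v_nonneg[OF norm_eq_1[OF k0(1)]] by (meson less_imp_le order_trans)
    have "continuous_on K (\<lambda>k. y + smul a (f k))" by (intro continuous_intros f)
    from v_upper_semicontinuous_on[OF in_sphere this k0(1) c(1)] obtain e where e: "0 < e"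
      "\<And>k. k \<in> K \<Longrightarrow> dist k k0 < e \<Longrightarrow> v k (y + smul a (f k)) \<le> c" by blast
    have vy: "v k y \<le> c" if "k \<in> K" "k \<noteq> k0" "dist k k0 < e" for k
      using e(2)[OF that(1,3)] v_add_null[OF norm_eq_1[OF that(1)] null[OF that(1,2)]] by simp
    define s where "s k = max 0 (1 - dist k k0 / e)" for k
    define g where "g k = smul (of_real (s k)) y" for k
    have s: "0 \<le> s k" "s k \<le> 1" for k using e(1) by (simp_all add: s_def)
    have g: "continuous_on K g"
      unfolding g_def s_def using e(1) by (intro continuous_intros) auto
    have g0: "g k0 = y" by (simp add: g_def s_def)
    have "w_orthogonal smul K f g"
      unfolding w_orthogonal_def
    proof
      fix b
      have "continuous_on K (\<lambda>k. f k + smul b (g k))" by (intro continuous_intros f g)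
      from v_le_w[OF this k0(1)] show "w f \<le> w (\<lambda>k. f k + smul b (g k))"
        using y by (simp add: g0 k0(2)[symmetric] v_orthogonal_def) (meson order_trans)
    qed
    then have "w_orthogonal smul K g f" using sym g by (simp add: nr_left_symmetric_def)
    then have "w g \<le> w (\<lambda>k. g k + smul a (f k))" by (simp add: w_orthogonal_def)
    also have "\<dots> \<le> c"
    proof (rule w_le)
      fix k assume k: "k \<in> K"
      show "v k (g k + smul a (f k)) \<le> c"
      proof (cases "k = k0")
        case True
        then show ?thesis using c(1) g0 by simp
      next
        case False
        have "v k (g k + smul a (f k)) = s k * v k y"
          using v_add_null[OF norm_eq_1[OF k] null[OF k False]]
            v_smul[OF norm_eq_1[OF k], of "of_real (s k)" y] s(1)[of k] by (simp add: g_def)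
        also have "\<dots> \<le> c"
        proof (cases "dist k k0 < e")
          case True
          have "s k * v k y \<le> 1 * c"
            using s vy[OF k False True] v_nonneg[OF norm_eq_1[OF k]] by (intro mult_mono) auto
          then show ?thesis by simp
        next
          case False
          then have "s k = 0" using e(1) by (simp add: s_def)
          then show ?thesis using c0 by simp
        qed
        finally show ?thesis .
      qed
    qed
    also have "c < v k0 (g k0)" using c(2) g0 by simp
    also have "\<dots> \<le> w g" by (rule v_le_w[OF g k0(1)])
    finally show False by simp
  qed
qed

text \<open>
  At points other than \<open>k0\<close> the seminorm of \<open>f + a g\<close> is at most \<open>norm a * w g\<close>. If
  \<open>v k0 (f k0) > 0\<close>, this is smaller than \<open>w f\<close> for small \<open>a\<close>, so \<open>w (f + a g) \<ge> w f\<close> can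
  only be due to the value at \<open>k0\<close>.
\<close>

lemma nr_left_symmetricI:
  assumes f: "continuous_on K f" and k0: "k0 \<in> K"
    and null: "\<And>k. k \<in> K \<Longrightarrow> k \<noteq> k0 \<Longrightarrow> v k (f k) = 0"
    and sym: "v_left_symmetric smul k0 (f k0)"
  shows "nr_left_symmetric smul K f"
  unfolding nr_left_symmetric_def
proof (intro allI impI)
  fix g assume g: "continuous_on K g" and fg: "w_orthogonal smul K f g"
  note n0 = norm_eq_1[OF k0]
  have wg: "0 \<le> w g" using v_nonneg[OF n0, of "g k0"] v_le_w[OF g k0] by simp
  have "v_orthogonal smul k0 (f k0) (g k0)"
  proof (cases "v k0 (f k0) = 0")
    case True
    then show ?thesis by (simp add: v_orthogonal_def v_nonneg[OF n0])
  next
    case False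
    then have m: "0 < v k0 (f k0)" using v_nonneg[OF n0, of "f k0"] by simp
    show ?thesis
    proof (rule v_orthogonal_local[OF n0])
      show "0 < v k0 (f k0) / (w g + 1)" using m wg by simp
      fix a :: 'k assume "norm a < v k0 (f k0) / (w g + 1)"
      then have "norm a * (w g + 1) < v k0 (f k0)" using wg by (simp add: field_simps)
      then have small: "norm a * w g < v k0 (f k0)"
        unfolding distrib_left using norm_ge_zero[of a] by linarith
      show "v k0 (f k0) \<le> v k0 (f k0 + smul a (g k0))"
      proof (rule ccontr)
        assume less: "\<not> ?thesis"
        have "w (\<lambda>k. f k + smul a (g k)) \<le> max (norm a * w g) (v k0 (f k0 + smul a (g k0)))"
        proof (rule w_le)
          fix k assume k: "k \<in> K"
          show "v k (f k + smul a (g k)) \<le> max (norm a * w g) (v k0 (f k0 + smul a (g k0)))"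
          proof (cases "k = k0")
            case False
            have "v k (f k + smul a (g k)) \<le> norm a * v k (g k)"
              using v_triangle[OF norm_eq_1[OF k], of "f k" "smul a (g k)"] null[OF k False]
              by (simp add: v_smul[OF norm_eq_1[OF k]])
            also have "\<dots> \<le> norm a * w g" by (intro mult_left_mono v_le_w[OF g k]) simp
            finally show ?thesis by simp
          qed simp
        qed
        also have "\<dots> < v k0 (f k0)" using small less by simp
        also have "\<dots> \<le> w f" by (rule v_le_w[OF f k0])
        finally show False using fg by (simp add: w_orthogonal_def not_less[symmetric])
      qed
    qed
  qed
  then have orth: "v_orthogonal smul k0 (g k0) (f k0)" using sym by (simp add: v_left_symmetric_def)
  show "w_orthogonal smul K g f"
    unfolding w_orthogonal_def
  proof
    fix a
    have cont: "continuous_on K (\<lambda>k. g k + smul a (f k))" by (intro continuous_intros f g)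
    show "w g \<le> w (\<lambda>k. g k + smul a (f k))"
    proof (rule w_le)
      fix k assume k: "k \<in> K"
      have "v k (g k) \<le> v k (g k + smul a (f k))"
      proof (cases "k = k0")
        case True
        then show ?thesis using orth by (simp add: v_orthogonal_def)
      next
        case False
        then show ?thesis using v_add_null[OF norm_eq_1[OF k] null[OF k False]] by simp
      qed
      also have "\<dots> \<le> w (\<lambda>k. g k + smul a (f k))" by (rule v_le_w[OF cont k])
      finally show "v k (g k) \<le> w (\<lambda>k. g k + smul a (f k))" .
    qed
  qed
qed

lemma v_eq_0_iff:
  assumes "k \<in> K"
  shows "v k x = 0 \<longleftrightarrow> (\<forall>\<phi>\<in>J smul k. \<phi> x = 0)"
proof
  assume "v k x = 0"
  then show "\<forall>\<phi>\<in>J smul k. \<phi> x = 0" using norm_le_v[of _ k x] by auto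
next
  assume "\<forall>\<phi>\<in>J smul k. \<phi> x = 0"
  then have "v k x \<le> 0" by (intro v_le[OF norm_eq_1[OF assms]]) auto
  then show "v k x = 0" using v_nonneg[OF norm_eq_1[OF assms], of x] by simp
qed

end

theorem theorem1p2:
  fixes smul :: "'k::real_or_complex \<Rightarrow> 'x::banach \<Rightarrow> 'x"
    and K :: "'x set" and f :: "'x \<Rightarrow> 'x"
  assumes "banach_space_over smul"
    and "compact K" and "K \<noteq> {}" and "K \<subseteq> sphere 0 1"
    and "continuous_on K f"
  shows "nr_left_symmetric smul K f \<longleftrightarrow>
    (\<exists>k0\<in>K. (\<forall>k\<in>K. k \<noteq> k0 \<longrightarrow> (\<forall>\<phi>\<in>J smul k. \<phi> (f k) = 0)) \<and>
             v_left_symmetric smul k0 (f k0))"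
proof -
  interpret compact_in_sphere smul K
    using assms(1-4) by (simp add: compact_in_sphere_def compact_in_sphere_axioms_def)
  show ?thesis
  proof
    assume sym: "nr_left_symmetric smul K f"
    obtain k0 where k0: "k0 \<in> K" "v k0 (f k0) = w f" using w_attained[OF assms(5)] by blast
    have null: "\<And>k. k \<in> K \<Longrightarrow> k \<noteq> k0 \<Longrightarrow> v k (f k) = 0"
      by (rule left_symmetric_imp_null[OF sym assms(5) k0])
    then show "\<exists>k0\<in>K. (\<forall>k\<in>K. k \<noteq> k0 \<longrightarrow> (\<forall>\<phi>\<in>J smul k. \<phi> (f k) = 0)) \<and>
        v_left_symmetric smul k0 (f k0)"
      using left_symmetric_imp_v_left_symmetric[OF sym assms(5) k0 null] k0(1) v_eq_0_iff by blast
  next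
    assume "\<exists>k0\<in>K. (\<forall>k\<in>K. k \<noteq> k0 \<longrightarrow> (\<forall>\<phi>\<in>J smul k. \<phi> (f k) = 0)) \<and>
        v_left_symmetric smul k0 (f k0)"
    then show "nr_left_symmetric smul K f"
      using nr_left_symmetricI[OF assms(5)] v_eq_0_iff by blast
  qed
qed

end
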